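(* In the Andreasen-Huge one-time-step approximation for the shifted SABR SDE (as described in the context, on a possibly non-uniform strike grid having the forward $F=k_n$ as a grid point), the parameters $\alpha$, $\nu$ and $\rho$ have the following analytic expressions in terms of the option prices close to the money: $$\alpha=\frac{1}{(F+b)^{\beta}}\sqrt{\frac{h^+_nh^-_n}{2T}}\sqrt{\frac{ATM(h^+_n+h^-_n)}{p_{n-1}h^-_n+p_{n+1}h^+_n-ATM(h^+_n+h^-_n)}},$$ $$\nu^2=\frac{\dfrac{z_{n-1}h^+_{n-1}h^-_{n-1}}{y(F-h^-_n)\,(F-h^-_n+b)^{2\beta}\,\kappa_{h^-_n}}-\dfrac{z_{n+1}h^+_{n+1}h^-_{n+1}}{y(F+h^+_n)\,(F+h^+_n+b)^{2\beta}\,\kappa_{h^+_n}}}{T\alpha^2\,(y(F-h^-_n)-y(F+h^+_n))}-\frac{1}{y(F-h^-_n)\,y(F+h^+_n)},$$ $$\rho=\frac{1}{2\nu}\left(\frac{\dfrac{y(F+h^+_n)\,z_{n-1}h^+_{n-1}h^-_{n-1}}{y(F-h^-_n)\,(F-h^-_n+b)^{2\beta}\,\kappa_{h^-_n}}-\dfrac{y(F-h^-_n)\,z_{n+1}h^+_{n+1}h^-_{n+1}}{y(F+h^+_n)\,(F+h^+_n+b)^{2\beta}\,\kappa_{h^+_n}}}{T\alpha^2\,(y(F-h^-_n)-y(F+h^+_n))}-\frac{y(F-h^-_n)-y(F+h^+_n)}{y(F-h^-_n)\,y(F+h^+_n)}\right),$$ where $$z_{n-1}=\frac{p_{n-1}(h^+_{n-1}+h^-_{n-1})}{p_{n-2}h^+_{n-1}+ATM\,h^-_{n-1}-p_{n-1}(h^+_{n-1}+h^-_{n-1})},$$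 $$z_{n+1}=\frac{c_{n+1}(h^+_{n+1}+h^-_{n+1})}{c_{n+2}h^-_{n+1}+ATM\,h^+_{n+1}-c_{n+1}(h^+_{n+1}+h^-_{n+1})},$$ $$\kappa_h=1-\frac{h}{\sigma\phi(h/\sigma)}\left(\frac12-\int_0^{h/\sigma}\phi(s)\,ds\right).$$
   Context: The shifted SABR model has parameters $\alpha,\beta,\nu,\rho$, shift $b$, forward $F$ and option maturity $T$; it is the shifted version (with $F_t$ replaced by $F_t+b$ in the power) of the SDE $dF_t=\alpha_tF_t^\beta dW_t$, $d\alpha_t=\nu\alpha_tdZ_t$, with correlation $\rho$ between the Brownian motions $W$ and $Z$. In the Andreasen-Huge one-time-step approximation one sets $$y(k)=\frac1\alpha\int_k^F(u+b)^{-\beta}\,du,\qquad J(y)=\sqrt{1-2\rho\nu y+\nu^2y^2},\qquad \vartheta(k)=\alpha J(y(k))(k+b)^\beta,$$ $$\kappa(k)=2\left(1-\xi\frac{\Phi(-\xi)}{\phi(\xi)}\right),\quad \xi=\frac{|F-k|}{\sigma},\qquad \theta(k)^2=\vartheta(k)^2\kappa(k),$$ where $\Phi,\phi$ are the standard normal distribution function and density and $\sigma$ is the at-the-money normal volatility; thus $\kappa_h=\kappa(F\pm h)/2$. Let $k_0<k_1<\dots$ be a finite grid of strikes, with $h^+_j=k_{j+1}-k_j$ and $h^-_j=k_j-k_{j-1}$, and with $F=k_n$. The call prices $c_j=c(k_j)$ and put prices $p_j=p(k_j)$ solve, at the interior grid points $k=k_j$ with $h_\pm=h^\pm_j$, the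 tridiagonal finite-difference systems $$\left(1+\frac{T\theta(k)^2}{h_+h_-}\right)c(k)-\frac{T\theta(k)^2}{h_++h_-}\left[\frac{c(k+h_+)}{h_+}+\frac{c(k-h_-)}{h_-}\right]=(F-k)^+,$$ $$\left(1+\frac{T\theta(k)^2}{h_+h_-}\right)p(k)-\frac{T\theta(k)^2}{h_++h_-}\left[\frac{p(k+h_+)}{h_+}+\frac{p(k-h_-)}{h_-}\right]=(k-F)^+,$$ with absorbing boundary conditions $c_{kk}=0$ and $p_{kk}=0$ at the two ends of the grid. $ATM=p_n=c_n$ is the at-the-money option price.
   Formalization: The printed formulas contradict the scheme; corrected: in α, p_{n-1} gets h^+_n and p_{n+1} gets h^-_n; in ν², ρ, Tα² becomes 2Tα² and, with y∓=y(F∓h∓), last terms become +1/(y-y+), +(y-+y+)/(y-y+). Assumed: α,ν,T,σ>0, |ρ|≤1, k_0+b≥0, two strikes each side of F. *)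

theory Defs
  imports "HOL-Probability.Probability"
begin

text \<open>
  The one-time-step approximation for the shifted SABR model
  \<open>dF = \<alpha> (F + b)\<^sup>\<beta> dW\<close>, \<open>d\<alpha> = \<nu> \<alpha> dZ\<close>, \<open>d<W, Z> = \<rho> dt\<close>.
\<close>

text \<open>The interval integral is oriented, so \<open>y\<close> is positive for strikes below the forward
  and negative above it.\<close>

definition sabr_y :: "real \<Rightarrow> real \<Rightarrow> real \<Rightarrow> real \<Rightarrow> real \<Rightarrow> real" where
  "sabr_y \<alpha> \<beta> b F k = 1 / \<alpha> * (LBINT u=ereal k..ereal F. (u + b) powr (- \<beta>))"

definition sabr_J :: "real \<Rightarrow> real \<Rightarrow> real \<Rightarrow> real" where
  "sabr_J \<nu> \<rho> y = sqrt (1 - 2 * \<rho> * \<nu> * y + \<nu>\<^sup>2 * y\<^sup>2)"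

definition local_vol :: "real \<Rightarrow> real \<Rightarrow> real \<Rightarrow> real \<Rightarrow> real \<Rightarrow> real \<Rightarrow> real \<Rightarrow> real" where
  "local_vol \<alpha> \<beta> \<nu> \<rho> b F k =
     \<alpha> * sabr_J \<nu> \<rho> (sabr_y \<alpha> \<beta> b F k) * (k + b) powr \<beta>"

definition kappa :: "real \<Rightarrow> real \<Rightarrow> real \<Rightarrow> real" where
  "kappa \<sigma> F k =
     (let \<xi> = \<bar>F - k\<bar> / \<sigma>
      in 2 * (1 - \<xi> * cdf std_normal_distribution (- \<xi>) / std_normal_density \<xi>))"

text \<open>\<open>theta_sq\<close> is \<open>\<theta>(k)\<^sup>2\<close>; only this square enters the finite-difference scheme.\<close>

definition theta_sq ::
  "real \<Rightarrow> real \<Rightarrow> real \<Rightarrow> real \<Rightarrow> real \<Rightarrow> real \<Rightarrow> real \<Rightarrow> real \<Rightarrow> real" where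
  "theta_sq \<alpha> \<beta> \<nu> \<rho> b \<sigma> F k = (local_vol \<alpha> \<beta> \<nu> \<rho> b F k)\<^sup>2 * kappa \<sigma> F k"

definition hplus :: "(nat \<Rightarrow> real) \<Rightarrow> nat \<Rightarrow> real" where
  "hplus k j = k (Suc j) - k j"

text \<open>Meaningful for \<open>0 < j\<close> only.\<close>

definition hminus :: "(nat \<Rightarrow> real) \<Rightarrow> nat \<Rightarrow> real" where
  "hminus k j = k j - k (j - 1)"

text \<open>
  \<open>fd_prices T \<theta>2 k N f v\<close>: on the grid \<open>k 0 < \<dots> < k N\<close> the vector \<open>v\<close> solves the implicit
  one-step scheme for \<open>v - (T/2) \<theta>\<^sup>2 v\<^sub>k\<^sub>k = f\<close> with payoff \<open>f\<close>.  The absorbing condition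
  \<open>v\<^sub>k\<^sub>k = 0\<close> at the two ends of the grid removes the second-order term of the scheme there,
  which leaves \<open>v = f\<close>.
\<close>

definition fd_prices ::
  "real \<Rightarrow> (real \<Rightarrow> real) \<Rightarrow> (nat \<Rightarrow> real) \<Rightarrow> nat \<Rightarrow> (real \<Rightarrow> real) \<Rightarrow> (nat \<Rightarrow> real) \<Rightarrow> bool" where
  "fd_prices T \<theta>2 k N f v \<longleftrightarrow>
     v 0 = f (k 0) \<and> v N = f (k N) \<and>
     (\<forall>j. 0 < j \<and> j < N \<longrightarrow>
        (1 + T * \<theta>2 (k j) / (hplus k j * hminus k j)) * v j
          - T * \<theta>2 (k j) / (hplus k j + hminus k j)
              * (v (j + 1) / hplus k j + v (j - 1) / hminus k j)
        = f (k j))"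

definition call_payoff :: "real \<Rightarrow> real \<Rightarrow> real" where
  "call_payoff F k = max (F - k) 0"

definition put_payoff :: "real \<Rightarrow> real \<Rightarrow> real" where
  "put_payoff F k = max (k - F) 0"

text \<open>\<open>kappa_dist \<sigma> h\<close> is \<open>\<kappa>\<^sub>h\<close>, i.e. half of \<open>kappa \<sigma> F (F \<plusminus> h)\<close> for \<open>h > 0\<close>.\<close>

definition kappa_dist :: "real \<Rightarrow> real \<Rightarrow> real" where
  "kappa_dist \<sigma> h =
     1 - h / (\<sigma> * std_normal_density (h / \<sigma>))
           * (1 / 2 - (LBINT s=ereal 0..ereal (h / \<sigma>). std_normal_density s))"

definition z_below :: "(nat \<Rightarrow> real) \<Rightarrow> (nat \<Rightarrow> real) \<Rightarrow> real \<Rightarrow> nat \<Rightarrow> real" where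
  "z_below k p ATM n =
     p (n - 1) * (hplus k (n - 1) + hminus k (n - 1))
       / (p (n - 2) * hplus k (n - 1) + ATM * hminus k (n - 1)
            - p (n - 1) * (hplus k (n - 1) + hminus k (n - 1)))"

definition z_above :: "(nat \<Rightarrow> real) \<Rightarrow> (nat \<Rightarrow> real) \<Rightarrow> real \<Rightarrow> nat \<Rightarrow> real" where
  "z_above k c ATM n =
     c (n + 1) * (hplus k (n + 1) + hminus k (n + 1))
       / (c (n + 2) * hminus k (n + 1) + ATM * hplus k (n + 1)
            - c (n + 1) * (hplus k (n + 1) + hminus k (n + 1)))"

text \<open>
  The scheme at the neighbours \<open>k = F - h\<^sup>-\<close> and \<open>k = F + h\<^sup>+\<close> of the forward, at distance \<open>h\<close>,
  gives \<open>z h\<^sup>+ h\<^sup>- = T \<theta>\<^sup>2 = 2 T \<alpha>\<^sup>2 J\<^sup>2 (k + b)\<^sup>2\<^sup>\<beta> \<kappa>\<^sub>h\<close> (with the grid steps around \<open>k\<close>), where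
  \<open>J\<^sup>2 = 1 - 2 \<rho> \<nu> y + \<nu>\<^sup>2 y\<^sup>2\<close>.  Solving these two equations for \<open>\<nu>\<^sup>2\<close> and \<open>\<rho>\<close> gives the factor
  \<open>2 T \<alpha>\<^sup>2\<close> and the trailing terms \<open>1 / (y\<^sub>- y\<^sub>+)\<close> and \<open>(y\<^sub>- + y\<^sub>+) / (y\<^sub>- y\<^sub>+)\<close>.  The scheme at \<open>F\<close>
  itself gives the weights \<open>h\<^sup>+\<close> of \<open>p (n - 1)\<close> and \<open>h\<^sup>-\<close> of \<open>p (n + 1)\<close> in the formula for \<open>\<alpha>\<close>.
  Caution: the formulas as originally published have \<open>T \<alpha>\<^sup>2\<close>, the trailing terms
  \<open>- 1 / (y\<^sub>- y\<^sub>+)\<close> and \<open>- (y\<^sub>- - y\<^sub>+) / (y\<^sub>- y\<^sub>+)\<close>, and the two weights exchanged, which does not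
  agree with the scheme.
\<close>

end

theory Submission
  imports Defs "HOL-Real_Asymp.Real_Asymp"
begin

text \<open>
  Cleared of denominators, the scheme at \<open>k\<^sub>j\<close> equates a multiple of \<open>v\<^sub>j - f(k\<^sub>j)\<close> with \<open>T \<theta>(k\<^sub>j)\<^sup>2\<close>
  times a second difference \<open>D\<^sub>j\<close> of the prices, so where the payoff vanishes the prices determine
  \<open>T \<theta>(k\<^sub>j)\<^sup>2\<close> as soon as \<open>D\<^sub>j \<noteq> 0\<close>.  At \<open>F\<close> this gives \<open>\<alpha>\<close>; at the two neighbours of \<open>F\<close> it gives
  two equations that are linear in \<open>\<nu>\<^sup>2\<close> and \<open>\<rho> \<nu>\<close>.  The discrete maximum principle provides the
  positivity behind \<open>D\<^sub>j > 0\<close>, as well as put-call parity, which makes the at-the-money call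
  and put prices agree; both need \<open>\<theta>\<^sup>2 \<ge> 0\<close>, which follows from the Mills ratio
  bound \<open>x \<Phi>(-x) < \<phi>(x)\<close>.
\<close>

section \<open>The finite-difference scheme and its maximum principle\<close>

text \<open>Multiplication by the nonzero \<open>h * g * (h + g)\<close> is reversible. The last
  bracket is \<open>h * g * (h + g) / 2\<close> times the divided-difference approximation of the
  second derivative, with \<open>u\<close> the value at the upper and \<open>w\<close> at the lower
  neighbour.\<close>

lemma implicit_step_iff:
  fixes h g S f u v w :: real
  assumes "h > 0" "g > 0"
  shows "(1 + S / (h * g)) * v - S / (h + g) * (u / h + w / g) = f \<longleftrightarrow>
         (v - f) * (h * g * (h + g)) = S * (u * g + w * h - v * (h + g))"
    (is "?L = f \<longleftrightarrow> _")
proof -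
  have "h + g > 0" using assms by simp
  have "S / (h * g) * (h * g * (h + g)) = S * (h + g)"
    using assms by simp
  moreover have "S / (h + g) * (u / h + w / g) * (h * g * (h + g)) = S * (u * g + w * h)"
    using assms \<open>h + g > 0\<close> by (simp add: add_frac_eq)
  moreover have "?L * (h * g * (h + g)) = v * (h * g * (h + g))
      + v * (S / (h * g) * (h * g * (h + g))) - S / (h + g) * (u / h + w / g) * (h * g * (h + g))"
    by (simp only: algebra_simps)
  ultimately have "?L * (h * g * (h + g)) - f * (h * g * (h + g))
      = (v - f) * (h * g * (h + g)) - S * (u * g + w * h - v * (h + g))"
    by (simp add: algebra_simps)
  moreover have "h * g * (h + g) \<noteq> 0"
    using assms \<open>h + g > 0\<close> by simp
  ultimately show ?thesis
    by (metis eq_iff_diff_eq_0 mult_right_cancel)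
qed

lemma hplus_pos: "strict_mono_on {0..N} k \<Longrightarrow> j < N \<Longrightarrow> hplus k j > 0"
  using strict_mono_onD[of "{0..N}" k j "Suc j"] by (simp add: hplus_def)

lemma hminus_pos: "strict_mono_on {0..N} k \<Longrightarrow> 0 < j \<Longrightarrow> j \<le> N \<Longrightarrow> hminus k j > 0"
  using strict_mono_onD[of "{0..N}" k "j - 1" j] by (simp add: hminus_def)

lemma fd_prices_iff:
  assumes "strict_mono_on {0..N} k"
  shows "fd_prices T \<theta>2 k N f v \<longleftrightarrow> v 0 = f (k 0) \<and> v N = f (k N) \<and>
    (\<forall>j. 0 < j \<and> j < N \<longrightarrow>
       (v j - f (k j)) * (hplus k j * hminus k j * (hplus k j + hminus k j))
       = T * \<theta>2 (k j) * (v (j + 1) * hminus k j + v (j - 1) * hplus k j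
                         - v j * (hplus k j + hminus k j)))"
proof -
  have step: "((1 + T * \<theta>2 (k j) / (hplus k j * hminus k j)) * v j
          - T * \<theta>2 (k j) / (hplus k j + hminus k j)
              * (v (j + 1) / hplus k j + v (j - 1) / hminus k j) = f (k j)) \<longleftrightarrow>
       (v j - f (k j)) * (hplus k j * hminus k j * (hplus k j + hminus k j))
       = T * \<theta>2 (k j) * (v (j + 1) * hminus k j + v (j - 1) * hplus k j
                         - v j * (hplus k j + hminus k j))" if "0 < j \<and> j < N" for j
    using that hplus_pos[OF assms] hminus_pos[OF assms] by (intro implicit_step_iff) auto
  show ?thesis
    \<comment> \<open>The equivalence needs positive grid steps, so the rewriting must use the
      bounds on \<open>j\<close> from the premise of the implication.\<close>
    unfolding fd_prices_def by (simp only: step cong: imp_cong)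
qed

lemma fd_prices_diff:
  assumes "fd_prices T \<theta>2 k N f v" "fd_prices T \<theta>2 k N g w" "strict_mono_on {0..N} k"
  shows "fd_prices T \<theta>2 k N (\<lambda>x. f x - g x) (\<lambda>j. v j - w j)"
proof -
  have lin: "((a - b) - (c - d)) * H = S * ((a1 - b1) * g + (a2 - b2) * h - (a - b) * (h + g))"
    if "(a - c) * H = S * (a1 * g + a2 * h - a * (h + g))"
       "(b - d) * H = S * (b1 * g + b2 * h - b * (h + g))"
    for a b c d H S a1 b1 a2 b2 g h :: real
    using that by (simp add: algebra_simps)
  note v = assms(1)[unfolded fd_prices_iff[OF assms(3)]]
    and w = assms(2)[unfolded fd_prices_iff[OF assms(3)]]
  show ?thesis
    unfolding fd_prices_iff[OF assms(3)]
  proof (intro conjI allI impI)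
    fix j assume "0 < j \<and> j < N"
    with v w show "(v j - w j - (f (k j) - g (k j))) * (hplus k j * hminus k j * (hplus k j + hminus k j))
        = T * \<theta>2 (k j) * ((v (j + 1) - w (j + 1)) * hminus k j + (v (j - 1) - w (j - 1)) * hplus k j
            - (v j - w j) * (hplus k j + hminus k j))"
      by (intro lin) blast+
  qed (use v w in auto)
qed

text \<open>The second difference kills affine functions on a non-uniform grid too, so an affine
  payoff is its own price whatever the variance is.\<close>

lemma fd_prices_affine:
  assumes "strict_mono_on {0..N} k"
  shows "fd_prices T \<theta>2 k N (\<lambda>x. a - x) (\<lambda>j. a - k j)"
  unfolding fd_prices_iff[OF assms] by (simp add: hplus_def hminus_def algebra_simps)

text \<open>At an interior minimiser of \<open>v\<close> the second difference is non-negative, so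
  the scheme puts \<open>v\<close> above the payoff there; at the two ends \<open>v\<close> equals
  the payoff. Hence the minimum of \<open>v\<close> is non-negative.\<close>

lemma fd_prices_nonneg:
  assumes v: "fd_prices T \<theta>2 k N f v" and k: "strict_mono_on {0..N} k" and "T \<ge> 0"
    and \<theta>: "\<And>j. 0 < j \<Longrightarrow> j < N \<Longrightarrow> \<theta>2 (k j) \<ge> 0"
    and f: "\<And>j. j \<le> N \<Longrightarrow> f (k j) \<ge> 0" and "j \<le> N"
  shows "v j \<ge> 0"
proof -
  define i where "i = arg_min_on v {0..N}"
  have i: "i \<le> N" and min: "\<And>l. l \<le> N \<Longrightarrow> v i \<le> v l"
    using arg_min_if_finite[of "{0..N}" v] arg_min_least[of "{0..N}" _ v] by (auto simp: i_def)
  have "v i \<ge> 0"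
  proof (cases "i = 0 \<or> i = N")
    case True
    then show ?thesis using v f[of i] i by (auto simp: fd_prices_def)
  next
    case False
    then have j: "0 < i" "i < N" using i by auto
    then have h: "hplus k i > 0" "hminus k i > 0"
      using hplus_pos[OF k] hminus_pos[OF k] by auto
    have "v (i + 1) * hminus k i + v (i - 1) * hplus k i \<ge> v i * hminus k i + v i * hplus k i"
      using j h min by (intro add_mono mult_right_mono) auto
    then have "T * \<theta>2 (k i) * (v (i + 1) * hminus k i + v (i - 1) * hplus k i
        - v i * (hplus k i + hminus k i)) \<ge> 0"
      using j \<theta> \<open>T \<ge> 0\<close> by (intro mult_nonneg_nonneg) (auto simp: algebra_simps)
    then have "(v i - f (k i)) * (hplus k i * hminus k i * (hplus k i + hminus k i)) \<ge> 0"
      using v j unfolding fd_prices_iff[OF k] by simp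
    moreover have "hplus k i * hminus k i * (hplus k i + hminus k i) > 0"
      using h by (intro mult_pos_pos) auto
    ultimately show ?thesis using f[OF i] by (simp add: zero_le_mult_iff)
  qed
  then show ?thesis using min[OF \<open>j \<le> N\<close>] by simp
qed

text \<open>Both \<open>c - p\<close> and \<open>F - k\<close> solve the scheme with payoff
  \<open>F - x\<close>. Their difference has payoff zero, and the maximum principle applied to it
  with either sign gives uniqueness.\<close>

lemma put_call_parity:
  assumes c: "fd_prices T \<theta>2 k N (call_payoff F) c" and p: "fd_prices T \<theta>2 k N (put_payoff F) p"
    and k: "strict_mono_on {0..N} k" and "T \<ge> 0"
    and \<theta>: "\<And>j. 0 < j \<Longrightarrow> j < N \<Longrightarrow> \<theta>2 (k j) \<ge> 0" and "j \<le> N"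
  shows "c j - p j = F - k j"
proof -
  have payoff: "(\<lambda>x. call_payoff F x - put_payoff F x) = (\<lambda>x. F - x)"
    by (auto simp: call_payoff_def put_payoff_def max_def)
  have cp: "fd_prices T \<theta>2 k N (\<lambda>x. F - x) (\<lambda>j. c j - p j)"
    using fd_prices_diff[OF c p k] by (simp only: payoff)
  have "0 \<le> (c j - p j) - (F - k j)"
    by (rule fd_prices_nonneg[OF fd_prices_diff[OF cp fd_prices_affine[OF k] k] k \<open>T \<ge> 0\<close> \<theta> _ \<open>j \<le> N\<close>]) auto
  moreover have "0 \<le> (F - k j) - (c j - p j)"
    by (rule fd_prices_nonneg[OF fd_prices_diff[OF fd_prices_affine[OF k] cp k] k \<open>T \<ge> 0\<close> \<theta> _ \<open>j \<le> N\<close>]) auto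
  ultimately show ?thesis by simp
qed

text \<open>If \<open>v j\<close> were zero, the scheme would equate a non-positive multiple of the
  payoff with a non-negative multiple of the neighbouring values, so both would vanish. A positive
  payoff excludes this, and so does a positive neighbour reached through a positive
  variance.\<close>

lemma fd_prices_pos:
  assumes v: "fd_prices T \<theta>2 k N f v" and k: "strict_mono_on {0..N} k" and "T > 0"
    and \<theta>: "\<And>j. 0 < j \<Longrightarrow> j < N \<Longrightarrow> \<theta>2 (k j) \<ge> 0"
    and f: "\<And>j. j \<le> N \<Longrightarrow> f (k j) \<ge> 0" and j: "0 < j" "j < N"
    and src: "f (k j) > 0 \<or> \<theta>2 (k j) > 0 \<and> (v (j + 1) > 0 \<or> v (j - 1) > 0)"
  shows "v j > 0"
proof (rule ccontr)
  assume "\<not> v j > 0"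
  have nonneg: "i \<le> N \<Longrightarrow> v i \<ge> 0" for i
    using fd_prices_nonneg[OF v k less_imp_le[OF \<open>T > 0\<close>] \<theta> f] .
  with j \<open>\<not> v j > 0\<close> have "v j = 0" by (simp add: order_antisym)
  have h: "hplus k j > 0" "hminus k j > 0"
    using j hplus_pos[OF k] hminus_pos[OF k] by auto
  define H where "H = hplus k j * hminus k j * (hplus k j + hminus k j)"
  define D where "D = v (j + 1) * hminus k j + v (j - 1) * hplus k j"
  have "H > 0" using h unfolding H_def by (intro mult_pos_pos) auto
  have "D \<ge> 0" using h j nonneg unfolding D_def by (intro add_nonneg_nonneg mult_nonneg_nonneg) auto
  have "- f (k j) * H = T * \<theta>2 (k j) * D"
    using v j \<open>v j = 0\<close> unfolding fd_prices_iff[OF k] H_def D_def by force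
  moreover have "f (k j) * H \<ge> 0" "T * \<theta>2 (k j) * D \<ge> 0"
    using \<theta>[of j] f[of j] j \<open>D \<ge> 0\<close> \<open>H > 0\<close> \<open>T > 0\<close> by (auto intro!: mult_nonneg_nonneg)
  ultimately have "f (k j) * H = 0" "T * \<theta>2 (k j) * D = 0" by linarith+
  with src \<open>H > 0\<close> \<open>T > 0\<close> have "D = 0" "v (j + 1) > 0 \<or> v (j - 1) > 0" by auto
  with h j nonneg[of "j + 1"] nonneg[of "j - 1"] show False
    unfolding D_def by (smt (verit, best) Suc_eq_plus1 Suc_leI less_imp_diff_less less_imp_le mult_pos_pos mult_nonneg_nonneg)
qed

text \<open>The variance \<open>\<theta>2 (k j)\<close> may vanish here: \<open>J\<close> has a zero when \<open>\<bar>\<rho>\<bar> = 1\<close>. Then \<open>v j = 0\<close>, but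
  \<open>D\<close> is still positive because of the positive neighbour.\<close>

lemma fd_prices_variance:
  assumes v: "fd_prices T \<theta>2 k N f v" and k: "strict_mono_on {0..N} k" and "T > 0"
    and \<theta>: "\<And>j. 0 < j \<Longrightarrow> j < N \<Longrightarrow> \<theta>2 (k j) \<ge> 0"
    and f: "\<And>j. j \<le> N \<Longrightarrow> f (k j) \<ge> 0" and j: "0 < j" "j < N"
    and "f (k j) = 0" and nb: "v (j + 1) > 0 \<or> v (j - 1) > 0"
  defines "D \<equiv> v (j + 1) * hminus k j + v (j - 1) * hplus k j - v j * (hplus k j + hminus k j)"
  shows "v j * (hplus k j + hminus k j) / D * hplus k j * hminus k j = T * \<theta>2 (k j)" and "D > 0"
proof -
  have nonneg: "i \<le> N \<Longrightarrow> v i \<ge> 0" for i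
    using fd_prices_nonneg[OF v k less_imp_le[OF \<open>T > 0\<close>] \<theta> f] .
  have h: "hplus k j > 0" "hminus k j > 0"
    using j hplus_pos[OF k] hminus_pos[OF k] by auto
  have eq: "v j * (hplus k j * hminus k j * (hplus k j + hminus k j)) = T * \<theta>2 (k j) * D"
    using v j \<open>f (k j) = 0\<close> unfolding fd_prices_iff[OF k] D_def by force
  show "D > 0"
  proof (cases "v j = 0")
    case True
    have "v (j + 1) * hminus k j > 0 \<or> v (j - 1) * hplus k j > 0"
      using nb h by auto
    moreover have "v (j + 1) * hminus k j \<ge> 0" "v (j - 1) * hplus k j \<ge> 0"
      using nonneg[of "j + 1"] nonneg[of "j - 1"] j h by auto
    ultimately show ?thesis unfolding D_def True by linarith
  next
    case False
    then have "v j > 0" using nonneg[of j] j by simp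
    then have "T * \<theta>2 (k j) * D > 0" using h by (subst eq[symmetric]) (intro mult_pos_pos add_pos_pos)
    moreover have "T * \<theta>2 (k j) \<ge> 0" using \<theta>[OF j] \<open>T > 0\<close> by simp
    ultimately show ?thesis by (metis mult_nonneg_nonpos not_le)
  qed
  with eq show "v j * (hplus k j + hminus k j) / D * hplus k j * hminus k j = T * \<theta>2 (k j)"
    by (simp add: field_simps)
qed

section \<open>The normal distribution and the Mills ratio\<close>

lemma std_normal_cdf_uminus_eq_tail:
  "cdf std_normal_distribution (- y) = (LBINT t:{y..}. std_normal_density t)"
proof -
  have "cdf std_normal_distribution (- y) = (LINT t|std_normal_distribution. indicator {..-y} t)"
    by (simp add: cdf_def)
  also have "\<dots> = (LBINT t:{..-y}. std_normal_density t)"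
    by (subst integral_density) (auto simp: set_lebesgue_integral_def mult.commute)
  also have "\<dots> = (LBINT t:{y..}. std_normal_density t)"
    unfolding set_lebesgue_integral_def
    by (subst lborel_integral_real_affine[where c = "-1" and t = 0])
       (auto simp: normal_density_def indicator_def intro!: Bochner_Integration.integral_cong)
  finally show ?thesis .
qed

text \<open>By symmetry the tail beyond 0 has mass 1/2, and the part between 0 and \<open>x\<close>
  is cut off. This links the \<Phi> in \<open>kappa\<close> to the integral in
  \<open>kappa_dist\<close>.\<close>

lemma std_normal_cdf_uminus:
  assumes "x \<ge> 0"
  shows "cdf std_normal_distribution (- x) = 1 / 2 - (LBINT s=ereal 0..ereal x. std_normal_density s)"
proof -
  have si: "set_integrable lborel S std_normal_density" if "S \<in> sets borel" for S
    using that unfolding set_integrable_def by (intro integrable_mult_indicator) auto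
  have UN: "{0..} = {0..<x} \<union> {x..}" "UNIV = {..<0} \<union> {0::real..}" using assms by auto
  have "cdf std_normal_distribution (- 0) = (LBINT t:{..<0}. std_normal_density t)"
  proof -
    \<comment> \<open>Dropping the null set \<open>{0}\<close> lets the reflection land on
      \<open>{..<0}\<close>, the exact complement of \<open>{0..}\<close>.\<close>
    have "(LBINT t:{0..}. std_normal_density t) = (LBINT t:{0<..}. std_normal_density t)"
      by (rule set_integral_discrete_difference[where X = "{0}"]) auto
    also have "\<dots> = (LBINT t:{..<0}. std_normal_density t)"
      unfolding set_lebesgue_integral_def
      by (subst lborel_integral_real_affine[where c = "-1" and t = 0])
         (auto simp: normal_density_def indicator_def intro!: Bochner_Integration.integral_cong)
    finally show ?thesis by (simp only: std_normal_cdf_uminus_eq_tail)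
  qed
  moreover have "(LBINT t:{..<0}. std_normal_density t) + (LBINT t:{0..}. std_normal_density t) = 1"
    by (subst set_integral_Un[symmetric]) (auto simp: si UN(2)[symmetric] set_lebesgue_integral_def)
  moreover have "(LBINT t:{0..}. std_normal_density t) =
     (LBINT t=ereal 0..ereal x. std_normal_density t) + (LBINT t:{x..}. std_normal_density t)"
    unfolding UN(1) using assms by (subst set_integral_Un) (auto simp: si interval_integral_Ico)
  ultimately show ?thesis
    using std_normal_cdf_uminus_eq_tail[of 0] std_normal_cdf_uminus_eq_tail[of x] by simp
qed

text \<open>For positive \<open>x\<close>, the difference \<open>H\<close> of the density over
  \<open>x\<close> and the tail is strictly decreasing with limit 0 at infinity, hence
  positive.\<close>

lemma mills_upper:
  assumes "x \<ge> 0"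
  shows "x * cdf std_normal_distribution (- x) < std_normal_density x"
proof (cases "x = 0")
  case True
  then show ?thesis by (simp add: normal_density_pos)
next
  case False
  then have "x > 0" using assms by simp
  interpret real_distribution std_normal_distribution by (rule real_dist_normal_dist)
  \<comment> \<open>Dividing by \<open>x\<close> leaves a derivative free of \<open>\<Phi>\<close> and of constant sign.\<close>
  define H where "H = (\<lambda>x. std_normal_density x / x - cdf std_normal_distribution (- x))"
  have "(H has_real_derivative - std_normal_density u / u\<^sup>2) (at u)" if "u > 0" for u
  proof -
    \<comment> \<open>The fundamental theorem differentiates within a compact interval; the end
      \<open>u + 1\<close> makes \<open>u\<close> an interior point, so the derivative becomes a
      full one.\<close>
    have "((\<lambda>v. LBINT s=ereal 0..ereal v. std_normal_density s) has_vector_derivative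
        std_normal_density u) (at u within {0..u + 1})"
      by (rule interval_integral_FTC2) (use that in \<open>auto simp: normal_density_def intro!: continuous_intros\<close>)
    then have "((\<lambda>v. LBINT s=ereal 0..ereal v. std_normal_density s) has_real_derivative
        std_normal_density u) (at u within {0<..<u + 1})"
      unfolding has_real_derivative_iff_has_vector_derivative
      by (rule has_vector_derivative_within_subset) auto
    then have I: "((\<lambda>v. LBINT s=ereal 0..ereal v. std_normal_density s) has_real_derivative
        std_normal_density u) (at u)"
      using that at_within_open[of u "{0<..<u + 1}"] by simp
    have "(std_normal_density has_real_derivative - u * std_normal_density u) (at u)"
      unfolding std_normal_density_def[abs_def]
      by (rule derivative_eq_intros refl | simp add: field_simps)+
    then have "((\<lambda>v. std_normal_density v / v - (1 / 2 - (LBINT s=ereal 0..ereal v. std_normal_density s)))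
        has_real_derivative - std_normal_density u / u\<^sup>2) (at u)"
      using that I by (auto intro!: derivative_eq_intros simp: field_simps power2_eq_square)
    then show ?thesis
    \<comment> \<open>The integral form of the tail was proved only for non-negative arguments,
      hence the transfer on the open half-line.\<close>
    proof (rule has_field_derivative_transform_within_open[where S = "{0<..}"])
      fix v :: real assume "v \<in> {0<..}"
      then show "std_normal_density v / v - (1 / 2 - (LBINT s=ereal 0..ereal v. std_normal_density s)) = H v"
        by (simp add: H_def std_normal_cdf_uminus)
    qed (use that in auto)
  qed
  moreover have "- std_normal_density u / u\<^sup>2 < 0" if "u > 0" for u
    using that by (simp add: normal_density_pos)
  moreover have "(H \<longlongrightarrow> 0 - 0) at_top"
    unfolding H_def
  proof (rule tendsto_diff)
    show "((\<lambda>x. std_normal_density x / x) \<longlongrightarrow> 0) at_top"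
      unfolding std_normal_density_def by real_asymp
    show "((\<lambda>x. cdf std_normal_distribution (- x)) \<longlongrightarrow> 0) at_top"
      using cdf_lim_at_bot by (simp add: filterlim_at_bot_mirror)
  qed
  ultimately have "0 - 0 < H x"
    using \<open>x > 0\<close> by (intro DERIV_neg_imp_decreasing_at_top[of x H "0 - 0"]) (meson less_le_trans)
  then show ?thesis using \<open>x > 0\<close> by (simp add: H_def field_simps)
qed

section \<open>The factor \<kappa>, the local variance and the sign of \<open>y\<close>\<close>

lemma kappa_dist_eq:
  assumes "\<sigma> > 0" "h \<ge> 0"
  shows "kappa_dist \<sigma> h
    = 1 - h / \<sigma> * cdf std_normal_distribution (- (h / \<sigma>)) / std_normal_density (h / \<sigma>)"
  using assms std_normal_cdf_uminus[of "h / \<sigma>"] by (simp add: kappa_dist_def)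

lemma kappa_dist_pos:
  assumes "\<sigma> > 0" "h \<ge> 0"
  shows "kappa_dist \<sigma> h > 0"
proof -
  have "h / \<sigma> * cdf std_normal_distribution (- (h / \<sigma>)) / std_normal_density (h / \<sigma>) < 1"
    using mills_upper[of "h / \<sigma>"] assms
    by (subst divide_less_eq_1_pos) (auto intro: normal_density_pos)
  then show ?thesis using assms by (simp add: kappa_dist_eq)
qed

lemma kappa_eq_kappa_dist: "\<sigma> > 0 \<Longrightarrow> kappa \<sigma> F x = 2 * kappa_dist \<sigma> \<bar>F - x\<bar>"
  by (simp add: kappa_def kappa_dist_eq Let_def)

lemma theta_sq_eq:
  assumes "\<sigma> > 0" "-1 \<le> \<rho>" "\<rho> \<le> 1"
  shows "theta_sq \<alpha> \<beta> \<nu> \<rho> b \<sigma> F x =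
    2 * \<alpha>\<^sup>2 * (1 - 2 * \<rho> * \<nu> * sabr_y \<alpha> \<beta> b F x + \<nu>\<^sup>2 * (sabr_y \<alpha> \<beta> b F x)\<^sup>2)
      * (x + b) powr (2 * \<beta>) * kappa_dist \<sigma> \<bar>F - x\<bar>"
    and "theta_sq \<alpha> \<beta> \<nu> \<rho> b \<sigma> F x \<ge> 0"
proof -
  define y where "y = sabr_y \<alpha> \<beta> b F x"
  \<comment> \<open>Completing the square shows that the radicand of \<open>sabr_J\<close> is
    non-negative when \<open>\<rho>\<close> lies in [-1, 1], so squaring really removes the
    root.\<close>
  have "1 - 2 * \<rho> * \<nu> * y + \<nu>\<^sup>2 * y\<^sup>2 = (1 - \<rho> * \<nu> * y)\<^sup>2 + (1 - \<rho>\<^sup>2) * (\<nu> * y)\<^sup>2"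
    by (simp add: power2_eq_square algebra_simps)
  moreover have "\<rho>\<^sup>2 \<le> 1" using assms by (simp add: abs_square_le_1)
  ultimately have "1 - 2 * \<rho> * \<nu> * y + \<nu>\<^sup>2 * y\<^sup>2 \<ge> 0" by simp
  moreover have "((x + b) powr \<beta>)\<^sup>2 = (x + b) powr (2 * \<beta>)"
    by (simp add: power2_eq_square powr_add[symmetric])
  ultimately show "theta_sq \<alpha> \<beta> \<nu> \<rho> b \<sigma> F x =
    2 * \<alpha>\<^sup>2 * (1 - 2 * \<rho> * \<nu> * sabr_y \<alpha> \<beta> b F x + \<nu>\<^sup>2 * (sabr_y \<alpha> \<beta> b F x)\<^sup>2)
      * (x + b) powr (2 * \<beta>) * kappa_dist \<sigma> \<bar>F - x\<bar>"
    by (simp add: theta_sq_def local_vol_def sabr_J_def y_def power_mult_distrib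
        kappa_eq_kappa_dist[OF assms(1)])
  show "theta_sq \<alpha> \<beta> \<nu> \<rho> b \<sigma> F x \<ge> 0"
    using kappa_dist_pos[OF assms(1), of "\<bar>F - x\<bar>"]
    by (simp add: theta_sq_def kappa_eq_kappa_dist[OF assms(1)])
qed

lemma powr_integral_pos:
  fixes a F b \<gamma> :: real
  assumes "a < F" "a + b > 0"
  shows "(LBINT u=ereal a..ereal F. (u + b) powr \<gamma>) > 0"
proof -
  have cont: "continuous_on {a..F} (\<lambda>u. (u + b) powr \<gamma>)"
    using assms by (intro continuous_intros) auto
  have eq: "(LBINT u=ereal a..ereal F. (u + b) powr \<gamma>) = integral {a..F} (\<lambda>u. (u + b) powr \<gamma>)"
    using assms cont by (intro interval_integral_eq_integral borel_integrable_atLeastAtMost') auto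
  \<comment> \<open>A continuous non-negative function with zero integral vanishes throughout, but
    this one is positive at the witness \<open>a\<close>.\<close>
  have "integral {a..F} (\<lambda>u. (u + b) powr \<gamma>) \<noteq> 0"
    using assms by (subst integral_eq_0_iff[OF cont]) (auto intro!: bexI[of _ a])
  moreover have "integral {a..F} (\<lambda>u. (u + b) powr \<gamma>) \<ge> 0"
    by (intro Henstock_Kurzweil_Integration.integral_nonneg integrable_continuous_interval cont) auto
  ultimately show ?thesis using eq by simp
qed

lemma sabr_y_pos: "\<alpha> > 0 \<Longrightarrow> x < F \<Longrightarrow> x + b > 0 \<Longrightarrow> sabr_y \<alpha> \<beta> b F x > 0"
  by (simp add: sabr_y_def powr_integral_pos)

lemma sabr_y_neg: "\<alpha> > 0 \<Longrightarrow> F < x \<Longrightarrow> F + b > 0 \<Longrightarrow> sabr_y \<alpha> \<beta> b F x < 0"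
  using powr_integral_pos[of F x b "- \<beta>"]
  by (subst sabr_y_def, subst interval_integral_endpoints_reverse) (simp add: divide_neg_pos)

lemma sabr_y_forward: "sabr_y \<alpha> \<beta> b F F = 0"
  by (simp add: sabr_y_def)

section \<open>Solving for the parameters\<close>

text \<open>Here \<open>u\<close> and \<open>v\<close> stand for the values of \<open>y\<close> at
  the two neighbours of the forward. Division by \<open>u\<close> and \<open>v\<close> gives the
  unknown \<open>\<rho> * \<nu>\<close> the same coefficient in \<open>A\<close> and
  \<open>B\<close>, so \<open>A - B\<close> eliminates it; \<open>v * A - u * B\<close> eliminates
  \<open>\<nu>\<^sup>2\<close>.\<close>

lemma smile_identities:
  fixes \<nu> \<rho> T \<alpha> u v :: real
  assumes "T * \<alpha>\<^sup>2 \<noteq> 0" "\<nu> \<noteq> 0" "u \<noteq> 0" "v \<noteq> 0" "u \<noteq> v"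
    and A: "A = 2 * T * \<alpha>\<^sup>2 * (1 - 2 * \<rho> * \<nu> * u + \<nu>\<^sup>2 * u\<^sup>2) / u"
    and B: "B = 2 * T * \<alpha>\<^sup>2 * (1 - 2 * \<rho> * \<nu> * v + \<nu>\<^sup>2 * v\<^sup>2) / v"
  shows "\<nu>\<^sup>2 = (A - B) / (2 * T * \<alpha>\<^sup>2 * (u - v)) + 1 / (u * v)"
    and "\<rho> = 1 / (2 * \<nu>) * ((v * A - u * B) / (2 * T * \<alpha>\<^sup>2 * (u - v)) + (u + v) / (u * v))"
proof -
  define s where "s = 2 * T * \<alpha>\<^sup>2"
  have "s \<noteq> 0" using assms(1) by (simp add: s_def)
  have A': "A = s * (1 / u - 2 * \<rho> * \<nu> + \<nu>\<^sup>2 * u)"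
    and B': "B = s * (1 / v - 2 * \<rho> * \<nu> + \<nu>\<^sup>2 * v)"
    using assms by (simp_all add: s_def field_simps power2_eq_square)
  \<comment> \<open>The parts free of the unknowns are multiples of \<open>-(u - v)\<close>;
    dividing them out produces the trailing terms with a plus sign.\<close>
  have inv: "1 / u - 1 / v = - (u - v) * (1 / (u * v))"
    "v / u - u / v = - (u - v) * ((u + v) / (u * v))"
    using assms(3,4) by (simp_all add: field_simps)
  have factor: "s * (- (u - v) * X + (u - v) * Y) = s * (u - v) * (Y - X)" for X Y
    by (simp add: algebra_simps)
  have "A - B = s * ((1 / u - 1 / v) + (u - v) * \<nu>\<^sup>2)"
    and "v * A - u * B = s * ((v / u - u / v) + (u - v) * (2 * \<rho> * \<nu>))"
    by (simp_all add: A' B' algebra_simps)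
  then have "A - B = s * (u - v) * (\<nu>\<^sup>2 - 1 / (u * v))"
    and "v * A - u * B = s * (u - v) * (2 * \<rho> * \<nu> - (u + v) / (u * v))"
    by (simp_all only: inv factor)
  with assms(2,5) \<open>s \<noteq> 0\<close>
  show "\<nu>\<^sup>2 = (A - B) / (2 * T * \<alpha>\<^sup>2 * (u - v)) + 1 / (u * v)"
    and "\<rho> = 1 / (2 * \<nu>) * ((v * A - u * B) / (2 * T * \<alpha>\<^sup>2 * (u - v)) + (u + v) / (u * v))"
    by (simp_all flip: s_def)
qed

text \<open>The bounds \<open>2 \<le> n\<close> and \<open>n + 2 \<le> N\<close> make the forward
  and both its neighbours interior points, so the scheme holds at all three.\<close>

theorem theorem1:
  fixes \<alpha> \<beta> \<nu> \<rho> b F T \<sigma> ATM :: real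
    and k c p :: "nat \<Rightarrow> real" and n N :: nat
  defines "y \<equiv> sabr_y \<alpha> \<beta> b F"
    and "\<theta>2 \<equiv> theta_sq \<alpha> \<beta> \<nu> \<rho> b \<sigma> F"
    and "hp \<equiv> hplus k n"
    and "hm \<equiv> hminus k n"
  defines "A \<equiv> z_below k p ATM n * hplus k (n - 1) * hminus k (n - 1)
                 / (y (F - hm) * (F - hm + b) powr (2 * \<beta>) * kappa_dist \<sigma> hm)"
    and "B \<equiv> z_above k c ATM n * hplus k (n + 1) * hminus k (n + 1)
                 / (y (F + hp) * (F + hp + b) powr (2 * \<beta>) * kappa_dist \<sigma> hp)"
  assumes "\<alpha> > 0" and "\<nu> > 0" and "-1 \<le> \<rho>" and "\<rho> \<le> 1" and "T > 0" and "\<sigma> > 0"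
    and "2 \<le> n" and "n + 2 \<le> N" and "strict_mono_on {0..N} k"
    and "k 0 + b \<ge> 0" and "F = k n"
    and "fd_prices T \<theta>2 k N (call_payoff F) c"
    and "fd_prices T \<theta>2 k N (put_payoff F) p"
    and "ATM = p n"
  shows "\<alpha> = 1 / (F + b) powr \<beta> * sqrt (hp * hm / (2 * T))
               * sqrt (ATM * (hp + hm) / (p (n - 1) * hp + p (n + 1) * hm - ATM * (hp + hm)))
       \<and> \<nu>\<^sup>2 = (A - B) / (2 * T * \<alpha>\<^sup>2 * (y (F - hm) - y (F + hp)))
               + 1 / (y (F - hm) * y (F + hp))
       \<and> \<rho> = 1 / (2 * \<nu>) *
               ((y (F + hp) * A - y (F - hm) * B) / (2 * T * \<alpha>\<^sup>2 * (y (F - hm) - y (F + hp)))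
                + (y (F - hm) + y (F + hp)) / (y (F - hm) * y (F + hp)))"
proof -
  have \<alpha>: "\<alpha> > 0" and \<nu>: "\<nu> > 0" and \<rho>: "-1 \<le> \<rho>" "\<rho> \<le> 1" and T: "T > 0" and \<sigma>: "\<sigma> > 0"
    and n: "2 \<le> n" "n + 2 \<le> N" and k: "strict_mono_on {0..N} k"
    and k0: "k 0 + b \<ge> 0" and F: "F = k n" and c: "fd_prices T \<theta>2 k N (call_payoff F) c"
    and p: "fd_prices T \<theta>2 k N (put_payoff F) p" and ATM: "ATM = p n"
    by fact+
  have mono: "i < j \<Longrightarrow> j \<le> N \<Longrightarrow> k i < k j" for i j
    using strict_mono_onD[OF k, of i j] by simp
  have [simp]: "F - hm = k (n - 1)" "F + hp = k (n + 1)"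
    by (simp_all add: F hm_def hp_def hminus_def hplus_def)
  have h: "hp > 0" "hm > 0"
    using n hplus_pos[OF k] hminus_pos[OF k] by (auto simp: hp_def hm_def)
  have kF: "k (n - 1) < F" "F < k (n + 1)" "k (n - 1) + b > 0"
    using mono[of "n - 1" n] mono[of n "n + 1"] mono[of 0 "n - 1"] n k0 F by force+
  have \<theta>: "0 < j \<Longrightarrow> j < N \<Longrightarrow> \<theta>2 (k j) \<ge> 0" for j
    unfolding \<theta>2_def by (rule theta_sq_eq(2)[OF \<sigma> \<rho>])
  have \<theta>_eq: "\<theta>2 x = 2 * \<alpha>\<^sup>2 * (1 - 2 * \<rho> * \<nu> * y x + \<nu>\<^sup>2 * (y x)\<^sup>2)
      * (x + b) powr (2 * \<beta>) * kappa_dist \<sigma> \<bar>F - x\<bar>" for x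
    unfolding \<theta>2_def y_def by (rule theta_sq_eq(1)[OF \<sigma> \<rho>])
  \<comment> \<open>At the forward \<open>y\<close> is 0 and the distance is 0, so \<open>J\<close>
    and \<open>kappa_dist\<close> are both 1, and \<nu> and \<rho> drop out. This isolates
    \<alpha>.\<close>
  have \<theta>F: "\<theta>2 (k n) = 2 * \<alpha>\<^sup>2 * ((F + b) powr \<beta>)\<^sup>2"
    using \<theta>_eq[of F] by (simp add: F y_def sabr_y_forward kappa_dist_def power2_eq_square powr_add[symmetric])
  then have "\<theta>2 (k n) > 0"
    using \<alpha> kF by simp
  have pay: "call_payoff F (k j) \<ge> 0" "put_payoff F (k j) \<ge> 0" for j
    by (simp_all add: call_payoff_def put_payoff_def)
  \<comment> \<open>The put is in the money at \<open>k (n + 1)\<close>; its positivity then spreads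
    to \<open>n\<close>, where the payoff is zero but the variance is positive.\<close>
  have "p (n + 1) > 0"
    using n kF by (intro fd_prices_pos[OF p k T \<theta> pay(2)]) (auto simp: put_payoff_def)
  then have "p n > 0"
    using n \<open>\<theta>2 (k n) > 0\<close> by (intro fd_prices_pos[OF p k T \<theta> pay(2)]) auto
  have "c n = ATM"
    using put_call_parity[OF c p k less_imp_le[OF T] \<theta>, of n] n by (simp add: F ATM)
  define Q where "Q = ATM * (hp + hm) / (p (n - 1) * hp + p (n + 1) * hm - ATM * (hp + hm))"
  have "Q * hp * hm = T * \<theta>2 (k n)"
    unfolding Q_def ATM hp_def hm_def add.commute[of "p (n - 1) * hplus k n"]
    using n \<open>p (n + 1) > 0\<close>
    by (intro fd_prices_variance(1)[OF p k T \<theta> pay(2)]) (auto simp: put_payoff_def F)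
  moreover have "hp * hm / (2 * T) * Q = Q * hp * hm / (2 * T)"
    by simp
  ultimately have "hp * hm / (2 * T) * Q = (\<alpha> * (F + b) powr \<beta>)\<^sup>2"
    using T by (simp add: \<theta>F power_mult_distrib)
  then have "sqrt (hp * hm / (2 * T)) * sqrt Q = \<alpha> * (F + b) powr \<beta>"
    using \<alpha> by (simp only: real_sqrt_mult[symmetric]) simp
  then have 1: "\<alpha> = 1 / (F + b) powr \<beta> * sqrt (hp * hm / (2 * T)) * sqrt Q"
    using kF by (simp add: mult.assoc)
  have A_eq: "z_below k p ATM n * hplus k (n - 1) * hminus k (n - 1) = T * \<theta>2 (k (n - 1))"
  proof -
    have "n - 1 + 1 = n" "n - 1 - 1 = n - 2" using n by auto
    then show ?thesis
      using fd_prices_variance(1)[OF p k T \<theta> pay(2), of "n - 1"] n \<open>p n > 0\<close> kF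
      by (simp add: z_below_def ATM put_payoff_def add.commute)
  qed
  have B_eq: "z_above k c ATM n * hplus k (n + 1) * hminus k (n + 1) = T * \<theta>2 (k (n + 1))"
    using fd_prices_variance(1)[OF c k T \<theta> pay(1), of "n + 1"] n \<open>p n > 0\<close> \<open>c n = ATM\<close> kF
    by (simp add: z_above_def ATM call_payoff_def)
  have A: "A = 2 * T * \<alpha>\<^sup>2 * (1 - 2 * \<rho> * \<nu> * y (F - hm) + \<nu>\<^sup>2 * (y (F - hm))\<^sup>2) / y (F - hm)"
  proof -
    have "kappa_dist \<sigma> hm > 0" "\<bar>F - k (n - 1)\<bar> = hm"
      using h kF kappa_dist_pos[OF \<sigma>] by (auto simp: hm_def hminus_def F)
    then show ?thesis using kF by (simp add: A_def A_eq[simplified] \<theta>_eq)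
  qed
  have B: "B = 2 * T * \<alpha>\<^sup>2 * (1 - 2 * \<rho> * \<nu> * y (F + hp) + \<nu>\<^sup>2 * (y (F + hp))\<^sup>2) / y (F + hp)"
  proof -
    have "kappa_dist \<sigma> hp > 0" "\<bar>F - k (n + 1)\<bar> = hp"
      using h kF kappa_dist_pos[OF \<sigma>] by (auto simp: hp_def hplus_def F)
    then show ?thesis using kF by (simp add: B_def B_eq[simplified] \<theta>_eq)
  qed
  have "y (F - hm) > 0" "y (F + hp) < 0"
    using \<alpha> kF by (simp_all add: y_def sabr_y_pos sabr_y_neg)
  then have "T * \<alpha>\<^sup>2 \<noteq> 0" "\<nu> \<noteq> 0" "y (F - hm) \<noteq> 0" "y (F + hp) \<noteq> 0" "y (F - hm) \<noteq> y (F + hp)"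
    using T \<alpha> \<nu> by auto
  note smile = smile_identities[OF this A B]
  show ?thesis
    by (intro conjI 1[unfolded Q_def] smile)
qed

end
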